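(* Let $n,p,k$ be positive integers. The positive number $\binom{n}{p}_k$ is an integer.
   Context: For an indeterminate $a$ and an integer $r\ge 0$, $(a)_r=a(a+1)\cdots(a+r-1)$ denotes the raising factorial, with $(a)_0=1$. For any positive integers $n,p,k$, define $$\binom{n}{p}_k=\binom{n}{k}\;{}_3F_2\!\left[\begin{matrix}1-k,\,-p,\,p-n\\ 1-n,\,1\end{matrix};1\right]=\binom{n}{k}\sum_{r\ge 0}\frac{(1-k)_r\,(-p)_r\,(p-n)_r}{(1-n)_r\,(1)_r\,r!},$$ where $\binom{n}{k}$ is the usual binomial coefficient, equal to $0$ for $k>n$. For $k\le n$ the sum terminates, since $(1-k)_r=0$ for $r\ge k$; for $k>n$ one has $\binom{n}{p}_k=0$ because of the factor $\binom{n}{k}$. The definition can be rewritten as $$\binom{n}{p}_k=\frac{n}{k}\sum_{r\ge 0}\binom{p}{r}\binom{n-p}{r}\binom{n-r-1}{k-r-1}.$$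
   Formalization: Integrality is proved for all positive n, p, k; positivity is asserted only for p ≤ n and k ≤ n, because the number is 0 when k > n and can be negative when p > n (n=2, p=3, k=2 gives -2). *)

theory Defs
  imports "HOL-Analysis.Analysis"
begin

(* The parameter 1 - n is a non-positive integer, but for 1 <= k <= n the numerator factor
   pochhammer (1 - k) r already vanishes for every r >= k, so each term whose denominator vanishes
   (r >= n) has the form 0 / 0 and is 0 by the HOL convention x / 0 = 0.  The series is thus the
   intended terminating sum over r < k.  For k > n the factor n choose k is 0.
   The difference p - n is taken in the reals, so p > n is not truncated. *)
definition gen_binomial :: "nat \<Rightarrow> nat \<Rightarrow> nat \<Rightarrow> real" where
  "gen_binomial n p k =
     real (n choose k) *
     eval_fps (fps_hypergeo [1 - real k, - real p, real p - real n] [1 - real n, 1] 1) 1"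

lemma gen_binomial_series:
  "gen_binomial n p k =
     real (n choose k) *
     (\<Sum>r. pochhammer (1 - real k) r * pochhammer (- real p) r * pochhammer (real p - real n) r /
           (pochhammer (1 - real n) r * pochhammer 1 r * fact r))"
  by (simp add: gen_binomial_def eval_fps_def)

lemma gen_binomial_finite_sum:
  assumes "k > 0"
  shows "gen_binomial n p k =
     real (n choose k) *
     (\<Sum>r<k. pochhammer (1 - real k) r * pochhammer (- real p) r * pochhammer (real p - real n) r /
           (pochhammer (1 - real n) r * pochhammer 1 r * fact r))"
proof -
  have "pochhammer (1 - real k) r = 0" if "r \<ge> k" for r
  proof -
    have "1 - real k = - real (k - 1)" using assms by simp
    moreover have "r > k - 1" using that assms by simp
    ultimately show ?thesis by (simp only: pochhammer_of_nat_eq_0_lemma)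
  qed
  then show ?thesis
    unfolding gen_binomial_series by (subst suminf_finite[of "{..<k}"]) auto
qed

end

theory Submission
  imports Defs
begin

(* For k \<le> n the definition is the sum of n / k * C(p, r) C(n-p, r) C(n-1-r, k-1-r) over r.
   Writing C(n-1-r, k-1-r) as an r-th backward difference of x \<mapsto> C(x, k-1) and summing over r first
   (Vandermonde) turns it into the sum of (-1)^j (n / k) C(n-1-j, k-1) C(p, j) C(n-j, p) over j.
   Absorption distributes the factor n / k over the binomials, since n = (n-j) + j, so every summand
   becomes an integer combination of binomial coefficients.  Generalised binomials keep each step
   valid for p > n, where n - p and n - j may be negative. *)

text \<open>By Pascal's rule each backward difference of C(x, m) lowers m by one and shifts x by
  one. The polynomial has degree m, so differences of order above m vanish, whence the
  \<open>else 0\<close>.\<close>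

lemma gbinomial_backward_difference:
  fixes a :: "'a::field_char_0"
  shows "(\<Sum>j\<le>r. (-1)^j * of_nat (r choose j) * (a - of_nat j gchoose m)) =
         (if r \<le> m then a - of_nat r gchoose (m - r) else 0)"
proof (induction r arbitrary: a)
  case 0
  show ?case by simp
next
  case (Suc r)
  define f where "f a j = (-1)^j * of_nat (r choose j) * (a - of_nat j gchoose m)" for a :: 'a and j
  define F where "F j = (-1)^j * of_nat (Suc r choose j) * (a - of_nat j gchoose m)" for j
  \<comment> \<open>Pascal's rule for \<open>Suc r choose Suc j\<close>, with
    \<open>a - of_nat (Suc j)\<close> read as \<open>(a - 1) - of_nat j\<close>.\<close>
  have step: "F (Suc j) = f a (Suc j) - f (a - 1) j" for j
    by (simp add: f_def F_def algebra_simps)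
  have "sum F {..Suc r} = F 0 + (\<Sum>j\<le>r. F (Suc j))"
    by (rule sum.atMost_Suc_shift)
  also have "\<dots> = (f a 0 + (\<Sum>j\<le>r. f a (Suc j))) - (\<Sum>j\<le>r. f (a - 1) j)"
    by (simp add: step sum_subtractf) (simp add: f_def F_def)
  also have "f a 0 + (\<Sum>j\<le>r. f a (Suc j)) = sum (f a) {..Suc r}"
    by (rule sum.atMost_Suc_shift [symmetric])
  also have "\<dots> = sum (f a) {..r}"
    by (simp add: f_def)
  finally have *: "sum F {..Suc r} = sum (f a) {..r} - sum (f (a - 1)) {..r}" .
  have sums: "sum (f b) {..r} = (if r \<le> m then b - of_nat r gchoose (m - r) else 0)" for b
    unfolding f_def by (rule Suc.IH)
  have "sum F {..Suc r} = (if Suc r \<le> m then a - of_nat (Suc r) gchoose (m - Suc r) else 0)"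
  proof (cases "Suc r \<le> m")
    case True
    then have "m - r = Suc (m - Suc r)" by simp
    then show ?thesis
      using True * gbinomial_addition_formula[of "a - of_nat r" "m - Suc r"]
      by (simp add: sums algebra_simps)
  next
    case False
    \<comment> \<open>For r = m both sums are 1 and cancel; for r > m both are 0.\<close>
    then show ?thesis using * by (auto simp: sums)
  qed
  then show ?case by (simp add: F_def)
qed

text \<open>Trinomial revision pulls C(p, j) out of the sum, and what remains is a Vandermonde
  convolution with upper entries q and p - j.\<close>

lemma sum_choose_mult_gbinomial:
  fixes q :: "'a::field_char_0"
  assumes "j \<le> p"
  shows "(\<Sum>r\<le>p. of_nat (r choose j) * of_nat (p choose r) * (q gchoose r)) =
         of_nat (p choose j) * (of_nat p + q - of_nat j gchoose p)"
proof -
  have "of_nat (r choose j) * of_nat (p choose r) * (q gchoose r) =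
        of_nat (p choose j) * ((q gchoose r) * (of_nat (p - j) gchoose (p - r)))"
    if "r \<le> p" for r
  proof (cases "j \<le> r")
    case True
    \<comment> \<open>The symmetric form C(p-j, p-r) makes the lower entries r and p - r add up to
      p, as Vandermonde requires.\<close>
    have "(r choose j) * (p choose r) = (p choose j) * (p - j choose (p - r))"
      using choose_mult[OF True that] binomial_symmetric[of "r - j" "p - j"] True that
      by (simp add: mult.commute)
    then show ?thesis
      by (simp flip: binomial_gbinomial of_nat_mult add: ac_simps)
  next
    case False
    then show ?thesis
      using that assms by (simp add: binomial_eq_0 del: of_nat_diff flip: binomial_gbinomial)
  qed
  then have "(\<Sum>r\<le>p. of_nat (r choose j) * of_nat (p choose r) * (q gchoose r)) =
      of_nat (p choose j) * (\<Sum>r\<le>p. (q gchoose r) * (of_nat (p - j) gchoose (p - r)))"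
    unfolding sum_distrib_left by (intro sum.cong refl) (simp only: atMost_iff)
  then show ?thesis
    unfolding gbinomial_Vandermonde [unfolded atLeast0AtMost] using assms by (simp add: algebra_simps)
qed

text \<open>The identity holds term by term: each rising factorial is (-1)^r r! times a binomial
  coefficient, and all signs and factorials cancel.\<close>

lemma gen_binomial_eq_sum:
  assumes "k > 0" "k \<le> n"
  shows "real k * gen_binomial n p k =
         real n * (\<Sum>r<k. real (p choose r) * (real n - real p gchoose r) *
                          real (n - 1 - r choose (k - 1 - r)))"
proof -
  have poch: "pochhammer (- a) r = (-1) ^ r * fact r * (a gchoose r)" for a :: real and r
    by (simp add: gbinomial_pochhammer flip: power_mult_distrib)
  have summand: "real k * (real (n choose k) * (pochhammer (1 - real k) r * pochhammer (- real p) r *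
        pochhammer (real p - real n) r / (pochhammer (1 - real n) r * pochhammer 1 r * fact r))) =
      real n * (real (p choose r) * (real n - real p gchoose r) *
                real (n - 1 - r choose (k - 1 - r)))"
    if "r < k" for r
  proof -
    have 1: "pochhammer (1 - real m) r = (-1) ^ r * fact r * real (m - 1 choose r)" if "m > 0" for m
      using poch[of "real (m - 1)" r] that by (simp add: binomial_gbinomial of_nat_diff)
    have 2: "pochhammer (real p - real n) r = (-1) ^ r * fact r * (real n - real p gchoose r)"
      using poch[of "real n - real p" r] by simp
    have 3: "pochhammer (- real p) r = (-1) ^ r * fact r * real (p choose r)"
      using poch[of "real p" r] by (simp add: binomial_gbinomial)
    \<comment> \<open>Since r < k \<le> n, no denominator in the truncated series vanishes.\<close>
    have nz: "real (n - 1 choose r) \<noteq> 0"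
      using that assms by simp
    have "k * (n choose k) * (k - 1 choose r) =
          n * ((n - 1 choose r) * (n - 1 - r choose (k - 1 - r)))"
      using choose_mult[of r "k - 1" "n - 1"] times_binomial_minus1_eq[of k n] that assms
      by (simp add: mult.assoc)
    then have 4: "real k * real (n choose k) * real (k - 1 choose r) =
          real n * (real (n - 1 choose r) * real (n - 1 - r choose (k - 1 - r)))"
      by (metis of_nat_mult)
    show ?thesis
      using nz assms 4
      by (simp add: 1 2 3 pochhammer_fact [symmetric] divide_simps ac_simps)
  qed
  show ?thesis
    unfolding gen_binomial_finite_sum[OF assms(1)] sum_distrib_left
    by (intro sum.cong refl) (simp only: summand lessThan_iff)
qed

lemma gen_binomial_eq_alternating_sum:
  assumes "k > 0" "k \<le> n"
  shows "real k * gen_binomial n p k =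
         real n * (\<Sum>j\<le>p. (-1)^j * (real n - 1 - real j gchoose (k - 1)) *
                          (real (p choose j) * (real n - real j gchoose p)))"
proof -
  define q where "q = real n - real p"
  \<comment> \<open>The right-hand side of \<open>gbinomial_backward_difference\<close> for a = n -
    1 and m = k - 1; its value 0 for r \<ge> k lets the range of r be changed from r < k to r \<le>
    p.\<close>
  define D where "D r = (if r \<le> k - 1 then real n - 1 - real r gchoose (k - 1 - r) else 0)" for r
  have D: "D r = (\<Sum>j\<le>p. (-1)^j * real (r choose j) * (real n - 1 - real j gchoose (k - 1)))"
    if "r \<le> p" for r
  proof -
    have "D r = (\<Sum>j\<le>r. (-1)^j * real (r choose j) * (real n - 1 - real j gchoose (k - 1)))"
      unfolding D_def by (rule gbinomial_backward_difference [symmetric])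
    also have "\<dots> = (\<Sum>j\<le>p. (-1)^j * real (r choose j) * (real n - 1 - real j gchoose (k - 1)))"
      using that by (intro sum.mono_neutral_left) (auto simp: binomial_eq_0)
    finally show ?thesis .
  qed
  have "(\<Sum>r<k. real (p choose r) * (q gchoose r) * real (n - 1 - r choose (k - 1 - r))) =
        (\<Sum>r<k. real (p choose r) * (q gchoose r) * D r)"
    using assms by (intro sum.cong refl) (auto simp: D_def binomial_gbinomial of_nat_diff algebra_simps)
  \<comment> \<open>A range containing both r < k and r \<le> p, so that k and p need not be
    compared.\<close>
  also have "\<dots> = (\<Sum>r<k + Suc p. real (p choose r) * (q gchoose r) * D r)"
    using assms by (intro sum.mono_neutral_left) (auto simp: D_def)
  also have "\<dots> = (\<Sum>r\<le>p. real (p choose r) * (q gchoose r) * D r)"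
    by (intro sum.mono_neutral_right) (auto simp: binomial_eq_0)
  also have "\<dots> = (\<Sum>r\<le>p. \<Sum>j\<le>p. (-1)^j * (real n - 1 - real j gchoose (k - 1)) *
                     (real (r choose j) * real (p choose r) * (q gchoose r)))"
    by (intro sum.cong refl) (simp add: D sum_distrib_left ac_simps)
  also have "\<dots> = (\<Sum>j\<le>p. (-1)^j * (real n - 1 - real j gchoose (k - 1)) *
                     (\<Sum>r\<le>p. real (r choose j) * real (p choose r) * (q gchoose r)))"
    by (subst sum.swap) (simp add: sum_distrib_left)
  also have "\<dots> = (\<Sum>j\<le>p. (-1)^j * (real n - 1 - real j gchoose (k - 1)) *
                     (real (p choose j) * (real n - real j gchoose p)))"
    by (intro sum.cong refl) (simp add: sum_choose_mult_gbinomial q_def)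
  finally show ?thesis
    by (simp add: gen_binomial_eq_sum[OF assms] q_def)
qed

lemma gbinomial_of_int_in_Ints: "(of_int a :: 'a::field_char_0) gchoose k \<in> \<int>"
  by (simp flip: of_int_gbinomial)

lemma gen_binomial_in_Ints:
  assumes "p > 0" "k > 0"
  shows "gen_binomial n p k \<in> \<int>"
proof (cases "k \<le> n")
  case False
  then show ?thesis by (simp add: gen_binomial_def binomial_eq_0)
next
  case True
  \<comment> \<open>The cofactor of n - j in n C(p, j) C(n-j, p), given without division so that j =
    n is covered. The second summand comes from the part j of n = (n-j) + j; it is 0 at j = 0, where
    the truncated \<open>j - 1\<close> would give a wrong value.\<close>
  define M where "M j = real (p choose j) * (real n - real j gchoose p) +
      (if j = 0 then 0 else real (p - 1 choose (j - 1)) * (real n - real j - 1 gchoose (p - 1)))" for j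
  have M: "real n * (real (p choose j) * (real n - real j gchoose p)) = (real n - real j) * M j" for j
  proof (cases "j = 0")
    case False
    define x where "x = real n - real j"
    have 1: "real p * (x gchoose p) = x * (x - 1 gchoose (p - 1))"
      using gbinomial_absorption[of "p - 1" x] assms by simp
    have 2: "real j * real (p choose j) = real p * real (p - 1 choose (j - 1))"
      using times_binomial_minus1_eq[of j p] False by (metis gr0I of_nat_mult)
    have "real n * (real (p choose j) * (x gchoose p)) =
        x * (real (p choose j) * (x gchoose p)) + (real j * real (p choose j)) * (x gchoose p)"
      by (simp add: x_def algebra_simps)
    also have "(real j * real (p choose j)) * (x gchoose p) =
        real (p - 1 choose (j - 1)) * (real p * (x gchoose p))"
      unfolding 2 by (simp add: ac_simps)
    also have "\<dots> = x * (real (p - 1 choose (j - 1)) * (x - 1 gchoose (p - 1)))"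
      unfolding 1 by (simp add: ac_simps)
    finally show ?thesis
      using False by (simp add: M_def x_def algebra_simps)
  qed (simp add: M_def)
  \<comment> \<open>The factor n - j split off above is absorbed here and yields the k that cancels
    on both sides.\<close>
  have absorb: "(real n - real j) * (real n - 1 - real j gchoose (k - 1)) =
      real k * (real n - real j gchoose k)" for j
    using gbinomial_absorption[of "k - 1" "real n - real j"] assms by (simp add: algebra_simps)
  have "real n * ((-1)^j * (real n - 1 - real j gchoose (k - 1)) *
          (real (p choose j) * (real n - real j gchoose p))) =
        real k * ((-1)^j * (real n - real j gchoose k) * M j)" for j
  proof -
    have "real n * ((-1)^j * (real n - 1 - real j gchoose (k - 1)) *
          (real (p choose j) * (real n - real j gchoose p))) =
        (-1)^j * (real n - 1 - real j gchoose (k - 1)) *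
          (real n * (real (p choose j) * (real n - real j gchoose p)))"
      by (simp only: ac_simps)
    also have "\<dots> = (-1)^j * ((real n - real j) * (real n - 1 - real j gchoose (k - 1))) * M j"
      unfolding M by (simp only: ac_simps)
    finally show ?thesis
      unfolding absorb by (simp only: ac_simps)
  qed
  then have "real k * gen_binomial n p k =
      real k * (\<Sum>j\<le>p. (-1)^j * (real n - real j gchoose k) * M j)"
    unfolding gen_binomial_eq_alternating_sum[OF assms(2) True] sum_distrib_left by (simp only:)
  then have eq: "gen_binomial n p k = (\<Sum>j\<le>p. (-1)^j * (real n - real j gchoose k) * M j)"
    using assms by simp
  \<comment> \<open>The upper entries may be negative, so integrality is taken from binomials over
    \<open>int\<close>.\<close>
  have int: "real n - real j gchoose m \<in> \<int>" "real n - real j - 1 gchoose m \<in> \<int>" for j m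
    using gbinomial_of_int_in_Ints[of "int n - int j" m, where 'a = real]
      gbinomial_of_int_in_Ints[of "int n - int j - 1" m, where 'a = real] by simp_all
  have "M j \<in> \<int>" for j
    unfolding M_def using int by (auto intro!: Ints_add Ints_mult)
  then show ?thesis
    unfolding eq using int by (intro Ints_sum Ints_mult Ints_power) auto
qed

text \<open>For p \<le> n all terms of \<open>gen_binomial_eq_sum\<close> are nonnegative, and the
  term r = 0 is C(n-1, k-1) > 0. For p > n the sign can change: n = k = 2, p = 3 gives -2.\<close>

lemma gen_binomial_pos:
  assumes "k > 0" "k \<le> n" "p \<le> n"
  shows "gen_binomial n p k > 0"
proof -
  define t where "t r = real (p choose r) * (real n - real p gchoose r) *
                        real (n - 1 - r choose (k - 1 - r))" for r
  have "real n - real p gchoose r = real (n - p choose r)" for r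
    using assms by (simp add: binomial_gbinomial of_nat_diff)
  then have "t r \<ge> 0" for r
    by (simp add: t_def)
  moreover have "t 0 > 0"
    using assms by (simp add: t_def)
  ultimately have "(\<Sum>r<k. t r) > 0"
    using assms by (intro sum_pos2[of _ 0]) auto
  then have "real k * gen_binomial n p k > 0"
    using assms unfolding gen_binomial_eq_sum[OF assms(1,2)] t_def by simp
  then show ?thesis
    using assms by (simp add: zero_less_mult_iff)
qed

theorem theorem1:
  fixes n p k :: nat
  assumes "n > 0" and "p > 0" and "k > 0"
  shows "gen_binomial n p k \<in> \<int> \<and> (p \<le> n \<and> k \<le> n \<longrightarrow> gen_binomial n p k > 0)"
  using assms gen_binomial_in_Ints gen_binomial_pos by blast

end
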